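(* Let $0<\theta<1$, $\xi\in[0,1)$, $y>0$ and $\lambda=(1-\xi)(1-\theta)$. Then, as $n\to\infty$, $$p_n^{\xi,y}(\theta)\sim\frac{1}{\lambda(\theta;\theta)_\infty}\,e^{\frac{\theta}{\theta-1}y}\,\lambda^{n+1}.$$
   Context: For $\xi\in[0,1]$ let $\phi_\xi(x)=\xi e^{x}$ for $x<0$ and $\phi_\xi(x)=(1-\xi)e^{-x}$ for $x>0$, and let $(X_i)_{i\ge0}$ be i.i.d. with density $\phi_\xi$. For $y\in\mathbb{R}$ put $p_0^{\xi,y}(\theta)=1$ and $p_n^{\xi,y}(\theta)=\mathbb{P}(X_2>\theta y,X_3>\theta X_2,\dots,X_{n+1}>\theta X_n)$ for $n\ge1$. $(a;q)_\infty=\prod_{k=0}^\infty(1-aq^k)$ for $0<q<1$. $a_n\sim b_n$ means $a_n/b_n\to1$. *)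

theory Defs
  imports "HOL-Probability.Probability" "HOL-Library.Landau_Symbols"
begin

text \<open>The value at \<open>x = 0\<close>, which the two-sided formula leaves open, is set to \<open>0\<close>; it is
  irrelevant for a density with respect to Lebesgue measure.\<close>

definition phi :: "real \<Rightarrow> real \<Rightarrow> real" where
  "phi \<xi> x = (if x < 0 then \<xi> * exp x else if x > 0 then (1 - \<xi>) * exp (- x) else 0)"

definition iid_phi :: "'a measure \<Rightarrow> real \<Rightarrow> (nat \<Rightarrow> 'a \<Rightarrow> real) \<Rightarrow> bool" where
  "iid_phi M \<xi> X \<longleftrightarrow>
     prob_space M \<and>
     prob_space.indep_vars M (\<lambda>_. borel) X UNIV \<and>
     (\<forall>i. distributed M lborel (X i) (\<lambda>x. ennreal (phi \<xi> x)))"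

text \<open>The parameter \<open>\<xi>\<close> enters only through the law of \<open>X\<close> (see \<open>iid_phi\<close>).\<close>

definition persist :: "'a measure \<Rightarrow> (nat \<Rightarrow> 'a \<Rightarrow> real) \<Rightarrow> real \<Rightarrow> real \<Rightarrow> nat \<Rightarrow> real" where
  "persist M X y \<theta> n =
     (if n = 0 then 1
      else measure M {\<omega> \<in> space M. X 2 \<omega> > \<theta> * y \<and> (\<forall>i\<in>{2..n}. X (i + 1) \<omega> > \<theta> * X i \<omega>)})"

definition qpochhammer_inf :: "real \<Rightarrow> real \<Rightarrow> real" where
  "qpochhammer_inf a q = (\<Prod>k. 1 - a * q ^ k)"

end

theory Submission
  imports Defs
begin

text \<open>
  As \<open>y > 0\<close>, all the variables stay positive on the persistence event, so only the exponential
  branch of the density matters. Integrating out the last variable \<open>x\<close> against \<open>exp (- \<theta> c x)\<close> over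
  \<open>x > \<theta> x'\<close> gives \<open>(1 - \<xi>) / (1 + \<theta> c) * exp (- \<theta> (1 + \<theta> c) x')\<close>, so the exponent \<open>c\<close> runs through
  the \<open>\<theta>\<close>-integers \<open>(1 - \<theta> ^ m) / (1 - \<theta>)\<close>. Iterating yields a closed form for the persistence
  probability with finite products in place of \<open>(\<theta>; \<theta>)\<^sub>\<infinity>\<close>.
\<close>

section \<open>Integrals under independence and exponential tails\<close>

text \<open>Independence makes the joint law a product measure, so Tonelli applies. With both
  integrals back over \<open>M\<close>, the inner one can be evaluated from the law of
  \<open>Y\<close> while \<open>U\<close> is frozen.\<close>

lemma (in prob_space) nn_integral_indep_pair:
  assumes ind: "indep_var S U T Y" and f [measurable]: "f \<in> borel_measurable (S \<Otimes>\<^sub>M T)"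
  shows "(\<integral>\<^sup>+\<omega>. f (U \<omega>, Y \<omega>) \<partial>M) = (\<integral>\<^sup>+\<omega>. (\<integral>\<^sup>+\<omega>'. f (U \<omega>, Y \<omega>') \<partial>M) \<partial>M)"
proof -
  have [measurable]: "U \<in> measurable M S" "Y \<in> measurable M T"
    using indep_var_rv1[OF ind] indep_var_rv2[OF ind] .
  interpret Y: prob_space "distr M T Y" by (rule prob_space_distr) simp
  have f' [measurable]: "f \<in> borel_measurable (distr M S U \<Otimes>\<^sub>M distr M T Y)"
    by simp
  have "(\<integral>\<^sup>+\<omega>. f (U \<omega>, Y \<omega>) \<partial>M) = integral\<^sup>N (distr M (S \<Otimes>\<^sub>M T) (\<lambda>\<omega>. (U \<omega>, Y \<omega>))) f"
    by (subst nn_integral_distr) auto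
  also have "\<dots> = integral\<^sup>N (distr M S U \<Otimes>\<^sub>M distr M T Y) f"
    using ind unfolding indep_var_distribution_eq by simp
  also have "\<dots> = (\<integral>\<^sup>+u. (\<integral>\<^sup>+x. f (u, x) \<partial>distr M T Y) \<partial>distr M S U)"
    by (rule Y.nn_integral_fst[symmetric, OF f'])
  also have "\<dots> = (\<integral>\<^sup>+\<omega>. (\<integral>\<^sup>+x. f (U \<omega>, x) \<partial>distr M T Y) \<partial>M)"
    by (rule nn_integral_distr) auto
  also have "\<dots> = (\<integral>\<^sup>+\<omega>. (\<integral>\<^sup>+\<omega>'. f (U \<omega>, Y \<omega>') \<partial>M) \<partial>M)"
    by (intro nn_integral_cong nn_integral_distr) (auto dest: measurable_space)
  finally show ?thesis .
qed

text \<open>One integration of the iteration, used with \<open>b = \<theta> * c\<close>. Since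
  \<open>a > 0\<close>, only the branch \<open>(1 - \<xi>) * exp (- x)\<close> is met, and its
  product with the weight is again an exponential, of rate \<open>1 + b\<close>.\<close>

lemma nn_integral_phi_tail:
  assumes D: "distributed M lborel Y (\<lambda>x. ennreal (phi \<xi> x))"
    and "\<xi> \<le> 1" "a > 0" "b \<ge> 0"
  shows "(\<integral>\<^sup>+\<omega>. indicator {a<..} (Y \<omega>) * ennreal (exp (- b * Y \<omega>)) \<partial>M)
    = ennreal ((1 - \<xi>) / (1 + b) * exp (- (1 + b) * a))"
proof -
  let ?g = "\<lambda>x. (1 - \<xi>) * exp (- (1 + b) * x)"
  let ?G = "\<lambda>x. - ((1 - \<xi>) / (1 + b)) * exp (- (1 + b) * x)"
  have "(\<integral>\<^sup>+\<omega>. indicator {a<..} (Y \<omega>) * ennreal (exp (- b * Y \<omega>)) \<partial>M)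
      = (\<integral>\<^sup>+x. ennreal (phi \<xi> x) * (indicator {a<..} x * ennreal (exp (- b * x))) \<partial>lborel)"
    using distributed_nn_integral[OF D, of "\<lambda>x. indicator {a<..} x * ennreal (exp (- b * x))"]
    by simp
  \<comment> \<open>The fundamental theorem of calculus is applied on a closed half-line; adding the
    endpoint \<open>a\<close> changes the integrand only on a null set.\<close>
  also have "\<dots> = (\<integral>\<^sup>+x. ennreal (?g x) * indicator {a..} x \<partial>lborel)"
  proof (rule nn_integral_cong_AE)
    have "ennreal (phi \<xi> x) * (indicator {a<..} x * ennreal (exp (- b * x)))
        = ennreal (?g x) * indicator {a..} x" if "x \<noteq> a" for x
      using that assms
      by (auto simp: phi_def indicator_def ennreal_mult'[symmetric] algebra_simps exp_add[symmetric])
    then show "AE x in lborel. ennreal (phi \<xi> x) * (indicator {a<..} x * ennreal (exp (- b * x)))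
        = ennreal (?g x) * indicator {a..} x"
      using AE_lborel_singleton[of a] by (auto elim: eventually_mono)
  qed
  also have "\<dots> = ennreal (0 - ?G a)"
  proof (rule nn_integral_FTC_atLeast)
    show "DERIV ?G x :> ?g x" for x
    proof -
      have b: "1 + b \<noteq> 0"
        using assms by linarith
      then have "DERIV ?G x :> - ((1 - \<xi>) / (1 + b)) * (exp (- (1 + b) * x) * - (1 + b))"
        by (auto intro!: derivative_eq_intros)
      moreover have "- (p / B) * (e * - B) = p * e" if "B \<noteq> 0" for p B e :: real
        using that by simp
      ultimately show ?thesis
        using b by metis
    qed
    have "((\<lambda>x::real. exp (- (1 + b) * x)) \<longlongrightarrow> 0) at_top"
      using assms
      by (intro filterlim_compose[OF exp_at_bot] filterlim_tendsto_neg_mult_at_bot[OF tendsto_const])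
        (auto simp: filterlim_ident)
    then show "(?G \<longlongrightarrow> 0) at_top"
      using tendsto_mult_right_zero by blast
  qed (use assms in auto)
  also have "0 - ?G a = (1 - \<xi>) / (1 + b) * exp (- (1 + b) * a)"
    by simp
  finally show ?thesis .
qed

section \<open>The persistence event as a condition on finitely many coordinates\<close>

text \<open>The starting point \<open>y\<close> takes the place of the unused variable \<open>X\<^sub>1\<close>.\<close>

definition chain :: "real \<Rightarrow> real \<Rightarrow> nat \<Rightarrow> (nat \<Rightarrow> real) \<Rightarrow> bool" where
  "chain \<theta> y n u \<longleftrightarrow> (\<forall>i\<in>{1..n}. (u(1 := y)) (i + 1) > \<theta> * (u(1 := y)) i)"

lemma chain_0 [simp]: "chain \<theta> y 0 u"
  by (simp add: chain_def)

lemma chain_Suc: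
  "chain \<theta> y (Suc n) u \<longleftrightarrow> chain \<theta> y n u \<and> u (n + 2) > \<theta> * (u(1 := y)) (n + 1)"
  by (auto simp: chain_def atLeastAtMostSuc_conv)

text \<open>Coordinate 1 is overwritten by \<open>y\<close>, so only the block from 2 to
  \<open>n + 1\<close> is read. This allows restricting the sequence to a finite block.\<close>

lemma chain_cong:
  assumes "\<And>i. i \<in> {2..n + 1} \<Longrightarrow> u i = v i"
  shows "chain \<theta> y n u \<longleftrightarrow> chain \<theta> y n v"
  unfolding chain_def using assms by (intro ball_cong) auto

text \<open>Each term exceeds \<theta> times a positive predecessor, starting from \<open>y\<close>.
  This supplies the positive threshold needed for the tail integral.\<close>

lemma chain_pos:
  assumes "chain \<theta> y n u" "\<theta> > 0" "y > 0"
  shows "(u(1 := y)) (n + 1) > 0"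
  using assms
proof (induction n)
  case (Suc n)
  then have "0 < \<theta> * (u(1 := y)) (n + 1)" "\<theta> * (u(1 := y)) (n + 1) < u (n + 2)"
    by (auto simp: chain_Suc)
  then show ?case by simp
qed simp

lemma measurable_chain [measurable]:
  "Measurable.pred (PiM {2..n + 1} (\<lambda>_. borel)) (chain \<theta> y n)"
proof -
  \<comment> \<open>Index 1 lies outside the product, but there the updated sequence is the constant
    \<open>y\<close>.\<close>
  have [measurable]: "(\<lambda>u. (u(1 := y)) j) \<in> borel_measurable (PiM {2..n + 1} (\<lambda>_. borel))"
    if "j \<in> {1..n + 1}" for j
    using that by (cases "j = 1") auto
  show ?thesis
    unfolding chain_def by measurable
qed

section \<open>Recursion and closed form for the persistence probability\<close>

locale iid_phi_start =
  fixes M :: "'a measure" and X :: "nat \<Rightarrow> 'a \<Rightarrow> real" and \<theta> \<xi> y :: real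
  assumes theta: "0 < \<theta>" "\<theta> < 1" and xi: "\<xi> < 1" and y: "y > 0"
    and iid: "iid_phi M \<xi> X"
begin

sublocale prob_space M
  using iid by (simp add: iid_phi_def)

text \<open>The Laplace transform of the last variable at \<open>\<theta> * c\<close>, restricted to
  the persistence event; for \<open>n = 0\<close> the last variable is \<open>y\<close>. The scaling
  by \<theta> is chosen so that one integration turns \<open>c\<close> into
  \<open>1 + \<theta> * c\<close>.\<close>

definition chain_laplace :: "nat \<Rightarrow> real \<Rightarrow> ennreal" where
  "chain_laplace n c = (\<integral>\<^sup>+\<omega>. indicator {u. chain \<theta> y n u} (\<lambda>i. X i \<omega>) *
     ennreal (exp (- (\<theta> * c) * ((\<lambda>i. X i \<omega>)(1 := y)) (n + 1))) \<partial>M)"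

lemma X_measurable [measurable]: "X i \<in> borel_measurable M"
  using iid by (auto simp: iid_phi_def distributed_def)

lemma chain_laplace_0: "chain_laplace 0 c = ennreal (exp (- (\<theta> * c) * y))"
  by (simp add: chain_laplace_def emeasure_space_1)

text \<open>Freeze the variables up to \<open>X (n + 1)\<close> and integrate out
  \<open>X (n + 2)\<close> over its tail beyond \<theta> times the last frozen value. The resulting
  exponential has the same shape, with a new \<open>c\<close>.\<close>

lemma chain_laplace_Suc:
  assumes "c \<ge> 0"
  shows "chain_laplace (Suc n) c = ennreal ((1 - \<xi>) / (1 + \<theta> * c)) * chain_laplace n (1 + \<theta> * c)"
proof -
  let ?S = "PiM {2..n + 1} (\<lambda>_. borel :: real measure)"
  let ?U = "\<lambda>\<omega>. \<lambda>i\<in>{2..n + 1}. X i \<omega>"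
  let ?T = "PiM {n + 2} (\<lambda>_. borel :: real measure)"
  let ?V = "\<lambda>\<omega>. \<lambda>i\<in>{n + 2}. X i \<omega>"
  define Z where "Z u = (u(1 := y)) (n + 1)" for u :: "nat \<Rightarrow> real"
  define f :: "(nat \<Rightarrow> real) \<times> (nat \<Rightarrow> real) \<Rightarrow> ennreal" where "f = (\<lambda>(u, v). indicator {u. chain \<theta> y n u} u *
    (indicator {\<theta> * Z u<..} (v (n + 2)) * ennreal (exp (- (\<theta> * c) * v (n + 2)))))"
  have Z_meas [measurable]: "Z \<in> borel_measurable ?S"
    unfolding Z_def by (cases n) auto
  have chain_meas [measurable]: "Measurable.pred ?S (chain \<theta> y n)"
    by (rule measurable_chain)
  \<comment> \<open>The threshold of the indicator depends on \<open>u\<close>; as a comparison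
    inside a conditional it is jointly measurable.\<close>
  have "f = (\<lambda>(u, v). (if chain \<theta> y n u \<and> \<theta> * Z u < v (n + 2)
      then ennreal (exp (- (\<theta> * c) * v (n + 2))) else 0))"
    by (auto simp: f_def fun_eq_iff)
  also have "\<dots> \<in> borel_measurable (?S \<Otimes>\<^sub>M ?T)"
    by measurable
  finally have f [measurable]: "f \<in> borel_measurable (?S \<Otimes>\<^sub>M ?T)" .
  have chain_U: "chain \<theta> y n (?U \<omega>) \<longleftrightarrow> chain \<theta> y n (\<lambda>i. X i \<omega>)" for \<omega>
    by (rule chain_cong) auto
  have Z_U: "Z (?U \<omega>) = ((\<lambda>i. X i \<omega>)(1 := y)) (n + 1)" for \<omega>
    by (auto simp: Z_def)
  have V: "?V \<omega> (n + 2) = X (n + 2) \<omega>" for \<omega>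
    by simp
  have "indep_vars (\<lambda>_. borel) X UNIV"
    using iid by (simp add: iid_phi_def)
  \<comment> \<open>The index blocks \<open>{2..n + 1}\<close> and \<open>{n + 2}\<close> are
    disjoint.\<close>
  then have ind: "indep_var ?S ?U ?T ?V"
    by (rule indep_var_restrict) auto
  have "chain_laplace (Suc n) c = (\<integral>\<^sup>+\<omega>. f (?U \<omega>, ?V \<omega>) \<partial>M)"
    unfolding chain_laplace_def
  proof (rule nn_integral_cong)
    fix \<omega>
    have "((\<lambda>i. X i \<omega>)(1 := y)) (Suc n + 1) = X (n + 2) \<omega>"
      by simp
    moreover have "indicator {u. chain \<theta> y (Suc n) u} (\<lambda>i. X i \<omega>) =
        (indicator {u. chain \<theta> y n u} (?U \<omega>) * indicator {\<theta> * Z (?U \<omega>)<..} (X (n + 2) \<omega>) :: ennreal)"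
      unfolding indicator_def mem_Collect_eq chain_Suc chain_U Z_U greaterThan_iff by simp
    ultimately show "indicator {u. chain \<theta> y (Suc n) u} (\<lambda>i. X i \<omega>) *
        ennreal (exp (- (\<theta> * c) * ((\<lambda>i. X i \<omega>)(1 := y)) (Suc n + 1))) = f (?U \<omega>, ?V \<omega>)"
      by (simp only: f_def prod.case V mult.assoc)
  qed
  also have "\<dots> = (\<integral>\<^sup>+\<omega>. (\<integral>\<^sup>+\<omega>'. f (?U \<omega>, ?V \<omega>') \<partial>M) \<partial>M)"
    by (rule nn_integral_indep_pair[OF ind f])
  also have "\<dots> = (\<integral>\<^sup>+\<omega>. ennreal ((1 - \<xi>) / (1 + \<theta> * c)) *
      (indicator {u. chain \<theta> y n u} (\<lambda>i. X i \<omega>) *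
       ennreal (exp (- (\<theta> * (1 + \<theta> * c)) * ((\<lambda>i. X i \<omega>)(1 := y)) (n + 1)))) \<partial>M)"
  proof (rule nn_integral_cong)
    fix \<omega>
    let ?z = "((\<lambda>i. X i \<omega>)(1 := y)) (n + 1)"
    show "(\<integral>\<^sup>+\<omega>'. f (?U \<omega>, ?V \<omega>') \<partial>M) = ennreal ((1 - \<xi>) / (1 + \<theta> * c)) *
        (indicator {u. chain \<theta> y n u} (\<lambda>i. X i \<omega>) * ennreal (exp (- (\<theta> * (1 + \<theta> * c)) * ?z)))"
    proof (cases "chain \<theta> y n (\<lambda>i. X i \<omega>)")
      case True
      have "?z > 0"
        by (rule chain_pos[OF True theta(1) y])
      have "(\<integral>\<^sup>+\<omega>'. f (?U \<omega>, ?V \<omega>') \<partial>M)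
          = (\<integral>\<^sup>+\<omega>'. indicator {\<theta> * ?z<..} (X (n + 2) \<omega>') *
              ennreal (exp (- (\<theta> * c) * X (n + 2) \<omega>')) \<partial>M)"
        unfolding f_def by (simp only: prod.case V Z_U chain_U indicator_simps mem_Collect_eq True mult_1)
      also have "\<dots> = ennreal ((1 - \<xi>) / (1 + \<theta> * c) * exp (- (1 + \<theta> * c) * (\<theta> * ?z)))"
        by (rule nn_integral_phi_tail) (use iid xi theta assms \<open>?z > 0\<close> in \<open>auto simp: iid_phi_def\<close>)
      also have "- (1 + \<theta> * c) * (\<theta> * ?z) = - (\<theta> * (1 + \<theta> * c)) * ?z"
        by (simp only: mult_ac minus_mult_left minus_mult_right)
      also have "ennreal ((1 - \<xi>) / (1 + \<theta> * c) * exp (- (\<theta> * (1 + \<theta> * c)) * ?z)) =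
          ennreal ((1 - \<xi>) / (1 + \<theta> * c)) * ennreal (exp (- (\<theta> * (1 + \<theta> * c)) * ?z))"
        by (rule ennreal_mult) (use xi theta assms in auto)
      finally show ?thesis
        using True by (simp only: indicator_simps mem_Collect_eq mult_1)
    next
      case False
      then show ?thesis
        unfolding f_def
        by (simp only: prod.case chain_U indicator_simps mem_Collect_eq not_False_eq_True
            mult_zero_left mult_zero_right nn_integral_const)
    qed
  qed
  also have "\<dots> = ennreal ((1 - \<xi>) / (1 + \<theta> * c)) * chain_laplace n (1 + \<theta> * c)"
    unfolding chain_laplace_def
  proof (rule nn_integral_cmult)
    \<comment> \<open>Measurability of \<open>chain\<close> is known on the finite product, so it is
      shown for the block \<open>?U\<close> and then carried over.\<close>
    have "(\<lambda>\<omega>. indicator {u. chain \<theta> y n u} (?U \<omega>) *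
        ennreal (exp (- (\<theta> * (1 + \<theta> * c)) * Z (?U \<omega>)))) \<in> borel_measurable M"
      using measurable_compose[OF _ chain_meas, of ?U M] indep_var_rv1[OF ind]
      by measurable
    then show "(\<lambda>\<omega>. indicator {u. chain \<theta> y n u} (\<lambda>i. X i \<omega>) *
        ennreal (exp (- (\<theta> * (1 + \<theta> * c)) * ((\<lambda>i. X i \<omega>)(1 := y)) (n + 1)))) \<in> borel_measurable M"
      unfolding indicator_def mem_Collect_eq chain_U Z_U .
  qed
  finally show ?thesis .
qed

text \<open>For \<open>c\<close> the \<theta>-integer of index \<open>m\<close>,
  \<open>1 + \<theta> * c\<close> is the one of index \<open>m + 1\<close>. The recursion thus
  shifts \<open>m\<close>, which is why it stays arbitrary in the induction, and contributes one
  denominator \<open>1 - \<theta> ^ Suc m\<close>.\<close>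

lemma chain_laplace_closed_form:
  "chain_laplace n ((1 - \<theta> ^ m) / (1 - \<theta>)) =
    ennreal (((1 - \<xi>) * (1 - \<theta>)) ^ n * exp (- (\<theta> * ((1 - \<theta> ^ (m + n)) / (1 - \<theta>))) * y) /
      (\<Prod>k<n. 1 - \<theta> ^ (m + Suc k)))"
proof (induction n arbitrary: m)
  case 0
  then show ?case by (simp add: chain_laplace_0)
next
  case (Suc n)
  let ?c = "(1 - \<theta> ^ m) / (1 - \<theta>)"
  have c: "?c \<ge> 0" "1 + \<theta> * ?c = (1 - \<theta> ^ Suc m) / (1 - \<theta>)"
    using theta by (auto simp: field_simps power_le_one)
  have pos: "1 - \<theta> ^ Suc m > 0"
    using theta power_Suc_less_one[of \<theta> m] by simp
  have "chain_laplace (Suc n) ?c = ennreal ((1 - \<xi>) / ((1 - \<theta> ^ Suc m) / (1 - \<theta>))) *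
      ennreal (((1 - \<xi>) * (1 - \<theta>)) ^ n * exp (- (\<theta> * ((1 - \<theta> ^ (Suc m + n)) / (1 - \<theta>))) * y) /
        (\<Prod>k<n. 1 - \<theta> ^ (Suc m + Suc k)))"
    unfolding chain_laplace_Suc[OF c(1)] c(2) Suc.IH ..
  also have "\<dots> = ennreal ((1 - \<xi>) / ((1 - \<theta> ^ Suc m) / (1 - \<theta>)) *
      (((1 - \<xi>) * (1 - \<theta>)) ^ n * exp (- (\<theta> * ((1 - \<theta> ^ (Suc m + n)) / (1 - \<theta>))) * y) /
        (\<Prod>k<n. 1 - \<theta> ^ (Suc m + Suc k))))"
    using pos theta xi by (intro ennreal_mult'[symmetric] divide_nonneg_nonneg) auto
  also have "(1 - \<xi>) / ((1 - \<theta> ^ Suc m) / (1 - \<theta>)) *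
      (((1 - \<xi>) * (1 - \<theta>)) ^ n * exp (- (\<theta> * ((1 - \<theta> ^ (Suc m + n)) / (1 - \<theta>))) * y) /
        (\<Prod>k<n. 1 - \<theta> ^ (Suc m + Suc k))) =
      ((1 - \<xi>) * (1 - \<theta>)) ^ Suc n * exp (- (\<theta> * ((1 - \<theta> ^ (m + Suc n)) / (1 - \<theta>))) * y) /
      (\<Prod>k<Suc n. 1 - \<theta> ^ (m + Suc k))"
    \<comment> \<open>The new denominator is the factor at \<open>k = 0\<close>; the others are
      those for \<open>Suc m\<close>, shifted by one.\<close>
    by (simp only: prod.lessThan_Suc_shift power_Suc add_Suc add_Suc_right add_0_right comp_def)
      (simp add: mult_ac)
  finally show ?case .
qed

text \<open>This is the case \<open>m = 0\<close>: the exponent \<open>c\<close> vanishes, so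
  \<open>chain_laplace\<close> is the probability of the event.\<close>

lemma persist_closed_form:
  "persist M X y \<theta> n = ((1 - \<xi>) * (1 - \<theta>)) ^ n *
    exp (- (\<theta> * ((1 - \<theta> ^ n) / (1 - \<theta>))) * y) / (\<Prod>k<n. 1 - \<theta> * \<theta> ^ k)"
proof -
  let ?A = "{\<omega> \<in> space M. chain \<theta> y n (\<lambda>i. X i \<omega>)}"
  have split: "{1..n} = insert 1 {2..n}" if "n \<noteq> 0"
    using that by auto
  have "persist M X y \<theta> n = measure M ?A"
  proof (cases "n = 0")
    case True
    then show ?thesis by (simp add: persist_def prob_space)
  next
    case False
    have "chain \<theta> y n u \<longleftrightarrow> u 2 > \<theta> * y \<and> (\<forall>i\<in>{2..n}. u (i + 1) > \<theta> * u i)" for u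
      unfolding chain_def split[OF False] by (auto simp: numeral_2_eq_2)
    with False show ?thesis by (simp add: persist_def)
  qed
  moreover have "emeasure M ?A = chain_laplace n ((1 - \<theta> ^ 0) / (1 - \<theta>))"
  proof -
    have "chain \<theta> y n (\<lambda>i\<in>{2..n + 1}. X i \<omega>) \<longleftrightarrow> chain \<theta> y n (\<lambda>i. X i \<omega>)" for \<omega>
      by (rule chain_cong) auto
    moreover have "Measurable.pred M (\<lambda>\<omega>. chain \<theta> y n (\<lambda>i\<in>{2..n + 1}. X i \<omega>))"
      by measurable
    ultimately have "?A \<in> sets M" by simp
    then have "emeasure M ?A = (\<integral>\<^sup>+\<omega>. indicator ?A \<omega> \<partial>M)" by simp
    also have "\<dots> = chain_laplace n ((1 - \<theta> ^ 0) / (1 - \<theta>))"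
      unfolding chain_laplace_def by (intro nn_integral_cong) (simp add: indicator_def)
    finally show ?thesis .
  qed
  \<comment> \<open>Positivity makes the closed form nonnegative, so it survives the passage from
    \<open>ennreal\<close> to reals.\<close>
  moreover have "(\<Prod>k<n. 1 - \<theta> * \<theta> ^ k) > 0"
    using theta power_Suc_less_one[of \<theta>] by (intro prod_pos) auto
  ultimately show ?thesis
    unfolding chain_laplace_closed_form measure_def using xi theta by simp
qed

end

section \<open>The infinite product and the asymptotics\<close>

lemma convergent_prod_qpochhammer:
  fixes a q :: real
  assumes "\<bar>q\<bar> < 1"
  shows "convergent_prod (\<lambda>k. 1 - a * q ^ k)"
proof (rule abs_convergent_prod_imp_convergent_prod, rule summable_imp_abs_convergent_prod)
  show "summable (\<lambda>k. norm (1 - a * q ^ k - 1))"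
    using assms by (simp add: abs_mult power_abs summable_mult summable_geometric)
qed

theorem lemma3p4:
  fixes M :: "'a measure" and X :: "nat \<Rightarrow> 'a \<Rightarrow> real" and \<theta> \<xi> y lam :: real
  assumes "0 < \<theta>" and "\<theta> < 1"
    and "0 \<le> \<xi>" and "\<xi> < 1"
    and "y > 0"
    and "lam = (1 - \<xi>) * (1 - \<theta>)"
    and "iid_phi M \<xi> X"
  shows "(\<lambda>n. persist M X y \<theta> n) \<sim>[sequentially]
    (\<lambda>n. 1 / (lam * qpochhammer_inf \<theta> \<theta>) * exp (\<theta> / (\<theta> - 1) * y) * lam ^ (n + 1))"
proof -
  interpret iid_phi_start M X \<theta> \<xi> y
    by unfold_locales (use assms in auto)
  let ?Q = "qpochhammer_inf \<theta> \<theta>"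
  have conv: "convergent_prod (\<lambda>k. 1 - \<theta> * \<theta> ^ k)"
    using theta by (intro convergent_prod_qpochhammer) auto
  \<comment> \<open>A convergent product with no zero factor has a nonzero value, so division by
    \<open>?Q\<close> is legitimate in the limit.\<close>
  have "1 - \<theta> * \<theta> ^ k \<noteq> 0" for k
    using theta power_Suc_less_one[of \<theta> k] by simp
  then have Q: "?Q \<noteq> 0"
    unfolding qpochhammer_inf_def by (intro prodinf_nonzero conv)
  have "(\<lambda>n. \<Prod>k\<le>n. 1 - \<theta> * \<theta> ^ k) \<longlonglongrightarrow> ?Q"
    unfolding qpochhammer_inf_def by (rule convergent_prod_LIMSEQ[OF conv])
  \<comment> \<open>Partial products over \<open>k \<le> n\<close> are those over
    \<open>k < Suc n\<close>; the index shift leaves the limit unchanged.\<close>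
  then have prod_lim: "(\<lambda>n. \<Prod>k<n. 1 - \<theta> * \<theta> ^ k) \<longlonglongrightarrow> ?Q"
    by (subst (asm) lessThan_Suc_atMost[symmetric]) (rule LIMSEQ_imp_Suc)
  have "(\<lambda>n. exp (- (\<theta> * ((1 - \<theta> ^ n) / (1 - \<theta>))) * y) / (\<Prod>k<n. 1 - \<theta> * \<theta> ^ k))
      \<longlonglongrightarrow> exp (- (\<theta> * ((1 - 0) / (1 - \<theta>))) * y) / ?Q"
    using theta Q by (intro tendsto_intros prod_lim LIMSEQ_realpow_zero) auto
  then have "(\<lambda>n. exp (- (\<theta> * ((1 - \<theta> ^ n) / (1 - \<theta>))) * y) / (\<Prod>k<n. 1 - \<theta> * \<theta> ^ k))
      \<sim>[sequentially] (\<lambda>_. exp (- (\<theta> * ((1 - 0) / (1 - \<theta>))) * y) / ?Q)"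
    by (rule tendsto_imp_asymp_equiv_const) (use Q in simp)
  then have "(\<lambda>n. lam ^ n * (exp (- (\<theta> * ((1 - \<theta> ^ n) / (1 - \<theta>))) * y) / (\<Prod>k<n. 1 - \<theta> * \<theta> ^ k)))
      \<sim>[sequentially] (\<lambda>n. lam ^ n * (exp (- (\<theta> * ((1 - 0) / (1 - \<theta>))) * y) / ?Q))"
    by (intro asymp_equiv_mult asymp_equiv_refl)
  moreover have "persist M X y \<theta> n =
      lam ^ n * (exp (- (\<theta> * ((1 - \<theta> ^ n) / (1 - \<theta>))) * y) / (\<Prod>k<n. 1 - \<theta> * \<theta> ^ k))" for n
    by (simp only: persist_closed_form assms(6) times_divide_eq_right)
  \<comment> \<open>The extra power of \<open>lam\<close> in the claim cancels its prefactor
    \<open>1 / lam\<close>.\<close>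
  moreover have "1 / (lam * ?Q) * exp (\<theta> / (\<theta> - 1) * y) * lam ^ (n + 1) =
      lam ^ n * (exp (- (\<theta> * ((1 - 0) / (1 - \<theta>))) * y) / ?Q)" for n
  proof -
    have "- (\<theta> * ((1 - 0) / (1 - \<theta>))) = \<theta> / (\<theta> - 1)"
      using theta by (simp add: field_simps)
    moreover have "lam \<noteq> 0"
      using assms by simp
    ultimately show ?thesis by simp
  qed
  ultimately show ?thesis by (simp only:)
qed

end
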